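(* Let $m\geq 1$ be an integer and let $\mathcal{M}$ be a matroid. If $\mathcal{M}$ satisfies $2$-Ray$[1]$ and $(1+1/k)^2$-Ray$[k]$ for all $2\leq k\leq m$, then $\mathcal{M}$ satisfies BLC$[2m+1]$.
   Context: Let $\mathcal{M}$ be a matroid on a finite ground set $E$, identified with its set of bases. Write $\mathbf{y}>\mathbf{0}$ for an assignment of positive real weights $\mathbf{y}=(y_e)_{e\in E}$, and $\mathbf{y}^A=\prod_{e\in A}y_e$. For disjoint $I,J\subseteq E$ let $M_I^J(\mathbf{y})=\sum \mathbf{y}^{B\setminus I}$, the sum over all bases $B$ of $\mathcal{M}$ with $I\subseteq B\subseteq E\setminus J$. For $S\subseteq E$ and an integer $j$ let $M_j(S,\mathbf{y})=\sum\mathbf{y}^B$, over all bases $B$ with $|B\cap S|=j$. For $S\subseteq E$ and integer $k$ let $\Psi_k M S(\mathbf{y})=\sum_{A\subseteq S,\ |A|=k} M_A^{S\setminus A}(\mathbf{y})\,M_{S\setminus A}^{A}(\mathbf{y})$. $\lambda$-Ray$[k]$ (for integer $k\ge1$, real $\lambda>0$): for all $\mathbf{y}>\mathbf{0}$ and all $S\subseteq E$ with $|S|=2k$, $\Psi_kMS(\mathbf{y})\geq\lambda\,\Psi_{k+1}MS(\mathbf{y})$. BLC$[m]$: for all $\mathbf{y}>\mathbf{0}$, all $S\subseteq E$ with $|S|=n\leq m$ and all $1\leq j\leq n-1$, $M_j(S,\mathbf{y})^2\geq\bigl[1+\frac{n+1}{j(n-j)}\bigr]M_{j-1}(S,\mathbf{y})M_{j+1}(S,\mathbf{y})$.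 *)

theory Defs
  imports Complex_Main
begin

locale matroid =
  fixes E :: "'a set" and M :: "'a set set"
  assumes finite_ground: "finite E"
    and bases_subset: "B \<in> M \<Longrightarrow> B \<subseteq> E"
    and bases_nonempty: "M \<noteq> {}"
    and basis_exchange:
      "\<lbrakk>B \<in> M; B' \<in> M; e \<in> B - B'\<rbrakk> \<Longrightarrow> \<exists>f\<in>B' - B. insert f (B - {e}) \<in> M"

text \<open>
  In what follows \<open>M\<close> is the set of bases of a matroid on \<open>E\<close>. Weights are functions on the whole
  type, but only their values on \<open>E\<close> matter.
\<close>

definition positive_weights :: "'a set \<Rightarrow> ('a \<Rightarrow> real) \<Rightarrow> bool" where
  "positive_weights E y \<longleftrightarrow> (\<forall>e\<in>E. 0 < y e)"

text \<open>
  The polynomial \<open>M\<^sub>I\<^sup>J(y)\<close>: elements of \<open>I\<close> are contracted (hence the weight of \<open>B - I\<close>) and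
  elements of \<open>J\<close> are deleted.
\<close>

definition minor_poly ::
  "'a set \<Rightarrow> 'a set set \<Rightarrow> 'a set \<Rightarrow> 'a set \<Rightarrow> ('a \<Rightarrow> real) \<Rightarrow> real" where
  "minor_poly E M I J y = (\<Sum>B\<in>{B \<in> M. I \<subseteq> B \<and> B \<subseteq> E - J}. \<Prod>e\<in>B - I. y e)"

definition level_poly :: "'a set set \<Rightarrow> nat \<Rightarrow> 'a set \<Rightarrow> ('a \<Rightarrow> real) \<Rightarrow> real" where
  "level_poly M j S y = (\<Sum>B\<in>{B \<in> M. card (B \<inter> S) = j}. \<Prod>e\<in>B. y e)"

definition Psi :: "nat \<Rightarrow> 'a set \<Rightarrow> 'a set set \<Rightarrow> 'a set \<Rightarrow> ('a \<Rightarrow> real) \<Rightarrow> real" where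
  "Psi k E M S y =
    (\<Sum>A\<in>{A. A \<subseteq> S \<and> card A = k}. minor_poly E M A (S - A) y * minor_poly E M (S - A) A y)"

definition Ray :: "real \<Rightarrow> nat \<Rightarrow> 'a set \<Rightarrow> 'a set set \<Rightarrow> bool" where
  "Ray c k E M \<longleftrightarrow>
    (\<forall>y S. positive_weights E y \<longrightarrow> S \<subseteq> E \<longrightarrow> card S = 2 * k \<longrightarrow>
      Psi k E M S y \<ge> c * Psi (k + 1) E M S y)"

definition BLC :: "nat \<Rightarrow> 'a set \<Rightarrow> 'a set set \<Rightarrow> bool" where
  "BLC m E M \<longleftrightarrow>
    (\<forall>y S n j. positive_weights E y \<longrightarrow> S \<subseteq> E \<longrightarrow> card S = n \<longrightarrow> n \<le> m \<longrightarrow>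
      1 \<le> j \<longrightarrow> j \<le> n - 1 \<longrightarrow>
      (level_poly M j S y)\<^sup>2 \<ge>
        (1 + (real n + 1) / (real j * (real n - real j))) *
          level_poly M (j - 1) S y * level_poly M (j + 1) S y)"

end

theory Submission
  imports Defs
begin

text \<open>
  Fix \<open>S\<close> and let \<open>p A\<close> be the total weight of the bases that meet \<open>S\<close> exactly in \<open>A\<close>. Both
  \<open>M\<^sub>j\<^sup>2\<close> and \<open>M\<^sub>j\<^sub>+\<^sub>1 M\<^sub>j\<^sub>-\<^sub>1\<close> are sums of products \<open>p A * p B\<close>; sort the pairs by
  \<open>I = A \<inter> B\<close> and \<open>U = (A \<union> B) - (A \<inter> B)\<close>, where \<open>card U = 2 i\<close>. For fixed \<open>I\<close> and \<open>U\<close> the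
  two sums are \<open>\<Psi>\<^sub>i\<close> and \<open>\<Psi>\<^sub>i\<^sub>+\<^sub>1\<close> on \<open>U\<close> of the minor that contracts \<open>I\<close> and deletes the rest of
  \<open>S\<close>, and a minor is a limit of reweightings, so the Ray conditions apply to it. For \<open>i \<ge> 2\<close> the
  factor \<open>(1 + 1/i)\<^sup>2\<close> is at least \<open>(1 + 1/j) (1 + 1/(n - j))\<close>, which is the BLC constant, since
  \<open>i \<le> min j (n - j)\<close>. For \<open>i = 1\<close> the factor is only 2, and the deficit is covered by the
  diagonal terms \<open>i = 0\<close>: the Johnson graph has degree \<open>j (n - j)\<close>, so the \<open>i = 1\<close> part is at
  most \<open>j (n - j)\<close> times the diagonal part.
\<close>

section \<open>Weights of bases sorted by their trace on \<open>S\<close>\<close>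

text \<open>In a matroid, for \<open>A \<subseteq> S\<close>, this is
  \<open>minor_poly E M A (S - A) y\<close> times the weight of \<open>A\<close>. Keeping that
  weight makes each level polynomial a plain sum of these terms.\<close>

definition trace_poly :: "'a set set \<Rightarrow> 'a set \<Rightarrow> 'a set \<Rightarrow> ('a \<Rightarrow> real) \<Rightarrow> real" where
  "trace_poly M S A y = (\<Sum>B\<in>{B \<in> M. B \<inter> S = A}. \<Prod>e\<in>B. y e)"

context matroid
begin

lemma finite_bases: "finite M"
  by (rule finite_subset[of _ "Pow E"]) (use bases_subset finite_ground in auto)

lemma finite_basis: "B \<in> M \<Longrightarrow> finite B"
  using bases_subset finite_ground finite_subset by metis

lemma trace_poly_nonneg:
  assumes "positive_weights E y"
  shows "0 \<le> trace_poly M S A y"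
  unfolding trace_poly_def
  by (intro sum_nonneg prod_nonneg)
    (use assms bases_subset in \<open>force simp: positive_weights_def intro: less_imp_le\<close>)

lemma level_poly_eq_sum_trace_poly:
  assumes "S \<subseteq> E"
  shows "level_poly M j S y = (\<Sum>A\<in>{A. A \<subseteq> S \<and> card A = j}. trace_poly M S A y)"
proof -
  have fin: "finite {A. A \<subseteq> S \<and> card A = j}"
    using assms finite_ground finite_subset[OF assms] by simp
  have "level_poly M j S y =
      (\<Sum>A\<in>{A. A \<subseteq> S \<and> card A = j}. \<Sum>B\<in>{B \<in> {B \<in> M. card (B \<inter> S) = j}. B \<inter> S = A}. \<Prod>e\<in>B. y e)"
    unfolding level_poly_def
    by (rule sum.group[symmetric]) (use fin finite_bases in auto)
  also have "\<dots> = (\<Sum>A\<in>{A. A \<subseteq> S \<and> card A = j}. trace_poly M S A y)"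
    unfolding trace_poly_def by (intro sum.cong) auto
  finally show ?thesis .
qed

text \<open>
  The weight \<open>y e / s\<close> on \<open>I\<close> and \<open>s * y e\<close> on \<open>S - I - U\<close> turns, as \<open>s\<close> tends to 0, into
  contraction of \<open>I\<close> and deletion of \<open>S - I - U\<close>.
\<close>

lemma Ray_trace_poly:
  assumes ray: "Ray c k E M" and pos: "positive_weights E y"
    and S: "S \<subseteq> E" and I: "I \<subseteq> S" and U: "U \<subseteq> S - I" and cardU: "card U = 2 * k"
  shows "c * (\<Sum>A\<in>{A. A \<subseteq> U \<and> card A = k + 1}.
            trace_poly M S (I \<union> A) y * trace_poly M S (I \<union> (U - A)) y)
      \<le> (\<Sum>A\<in>{A. A \<subseteq> U \<and> card A = k}.
            trace_poly M S (I \<union> A) y * trace_poly M S (I \<union> (U - A)) y)"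
proof -
  define D where "D = S - I - U"
  define v where "v s e = (if e \<in> I then 1 / s else if e \<in> D then s else 1 :: real)" for s e
  define w where "w s e = y e * v s e" for s e
  \<comment> \<open>The minor polynomial of the reweighting, multiplied by \<open>s ^ card I\<close>
    to cancel every negative power of \<open>s\<close>. What remains is a polynomial in
    \<open>s\<close>, so the limit is its value at 0.\<close>
  define q where "q A s = (\<Sum>B\<in>{B \<in> M. A \<subseteq> B \<and> B \<subseteq> E - (U - A)}.
      s ^ (card (I - B) + card (B \<inter> D)) * (\<Prod>e\<in>B - A. y e))" for A and s :: real
  have finI: "finite I" and finU: "finite U" and finD: "finite D"
    using I U S finite_ground by (auto simp: D_def intro: finite_subset)
  have prod_v: "s ^ card I * (\<Prod>e\<in>B - A. v s e) = s ^ (card (I - B) + card (B \<inter> D))"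
    if s: "s > 0" and B: "B \<in> M" and A: "A \<subseteq> U" for s A B
  proof -
    have fB: "finite B" using B finite_basis by blast
    have "(\<Prod>e\<in>B - A. v s e) = (\<Prod>e\<in>(B - A) \<inter> (I \<union> D). v s e)"
      by (rule prod.mono_neutral_right) (use fB in \<open>auto simp: v_def\<close>)
    also have "(B - A) \<inter> (I \<union> D) = (I \<inter> B) \<union> (B \<inter> D)"
      using A U by (auto simp: D_def)
    also have "(\<Prod>e\<in>(I \<inter> B) \<union> (B \<inter> D). v s e) = (\<Prod>e\<in>I \<inter> B. v s e) * (\<Prod>e\<in>B \<inter> D. v s e)"
      by (rule prod.union_disjoint) (use fB in \<open>auto simp: D_def\<close>)
    also have "(\<Prod>e\<in>I \<inter> B. v s e) = (1 / s) ^ card (I \<inter> B)"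
      by (simp add: v_def)
    also have "(\<Prod>e\<in>B \<inter> D. v s e) = (\<Prod>e\<in>B \<inter> D. s)"
      by (rule prod.cong) (auto simp: v_def D_def)
    finally have "(\<Prod>e\<in>B - A. v s e) = (1 / s) ^ card (I \<inter> B) * s ^ card (B \<inter> D)"
      by simp
    moreover have "card I = card (I \<inter> B) + card (I - B)"
      using finI by (metis card_Int_Diff)
    ultimately show ?thesis
      using s by (simp add: power_add power_divide)
  qed
  have minor_w: "s ^ card I * minor_poly E M A (U - A) (w s) = q A s"
    if s: "s > 0" and A: "A \<subseteq> U" for s A
  proof -
    have "s ^ card I * (\<Prod>e\<in>B - A. w s e)
        = s ^ (card (I - B) + card (B \<inter> D)) * (\<Prod>e\<in>B - A. y e)" if "B \<in> M" for B
      using prod_v[OF s that A] by (simp add: w_def prod.distrib mult.left_commute)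
    then show ?thesis
      unfolding minor_poly_def q_def sum_distrib_left by (intro sum.cong) auto
  qed
  \<comment> \<open>Since \<open>0 ^ 0 = 1\<close>, exactly the bases with exponent 0 survive: those
    that contain \<open>I\<close> and avoid \<open>D\<close>.\<close>
  have q_0: "(\<Prod>e\<in>A. y e) * q A 0 = trace_poly M S (I \<union> A) y" if A: "A \<subseteq> U" for A
  proof -
    have trace: "{B \<in> {B \<in> M. A \<subseteq> B \<and> B \<subseteq> E - (U - A)}. I - B = {} \<and> B \<inter> D = {}}
        = {B \<in> M. B \<inter> S = I \<union> A}"
      using A I U S bases_subset by (auto simp: D_def) blast+
    have "(\<Prod>e\<in>A. y e) * q A 0 = (\<Sum>B\<in>{B \<in> M. A \<subseteq> B \<and> B \<subseteq> E - (U - A)}.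
        if I - B = {} \<and> B \<inter> D = {} then (\<Prod>e\<in>B. y e) else 0)"
      unfolding q_def sum_distrib_left
    proof (intro sum.cong refl)
      fix B assume B: "B \<in> {B \<in> M. A \<subseteq> B \<and> B \<subseteq> E - (U - A)}"
      then have fB: "finite B" using finite_basis by blast
      have "(\<Prod>e\<in>A. y e) * (\<Prod>e\<in>B - A. y e) = (\<Prod>e\<in>B. y e)"
        using prod.subset_diff[of A B y] B fB by (simp add: mult.commute)
      then show "(\<Prod>e\<in>A. y e) * (0 ^ (card (I - B) + card (B \<inter> D)) * (\<Prod>e\<in>B - A. y e))
          = (if I - B = {} \<and> B \<inter> D = {} then (\<Prod>e\<in>B. y e) else 0)"
        using finI fB by (auto simp: power_0_left card_eq_0_iff)
    qed
    also have "\<dots> = trace_poly M S (I \<union> A) y"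
      unfolding trace_poly_def trace[symmetric]
      by (rule sum.inter_filter[symmetric]) (use finite_bases in auto)
    finally show ?thesis .
  qed
  define Q where "Q l s = (\<Sum>A\<in>{A. A \<subseteq> U \<and> card A = l}. q A s * q (U - A) s)" for l s
  have Psi_w: "(s ^ card I)\<^sup>2 * Psi l E M U (w s) = Q l s" if s: "s > 0" for l s
  proof -
    have "(s ^ card I)\<^sup>2 * (minor_poly E M A (U - A) (w s) * minor_poly E M (U - A) A (w s))
        = q A s * q (U - A) s" if A: "A \<subseteq> U" for A
    proof -
      have "U - (U - A) = A" using A by auto
      then have "s ^ card I * minor_poly E M (U - A) A (w s) = q (U - A) s"
        using minor_w[OF s, of "U - A"] by auto
      then show ?thesis
        unfolding minor_w[OF s A, symmetric] by (simp add: power2_eq_square mult_ac)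
    qed
    then show ?thesis
      unfolding Psi_def Q_def sum_distrib_left by (intro sum.cong) auto
  qed
  have Q_ineq: "c * Q (k + 1) s \<le> Q k s" if s: "s > 0" for s
  proof -
    have "positive_weights E (w s)"
      using pos s by (auto simp: positive_weights_def w_def v_def)
    moreover have "U \<subseteq> E" using U S by auto
    ultimately have "c * Psi (k + 1) E M U (w s) \<le> Psi k E M U (w s)"
      using ray cardU unfolding Ray_def by blast
    then have "(s ^ card I)\<^sup>2 * (c * Psi (k + 1) E M U (w s)) \<le> (s ^ card I)\<^sup>2 * Psi k E M U (w s)"
      by (rule mult_left_mono) simp
    then show ?thesis
      by (simp add: Psi_w[OF s, symmetric] mult.left_commute)
  qed
  have lim: "(Q l \<longlongrightarrow> Q l 0) (at_right 0)" for l
    unfolding Q_def q_def by (intro tendsto_intros)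
  have Q_ineq_0: "c * Q (k + 1) 0 \<le> Q k 0"
  proof (rule tendsto_le)
    show "((\<lambda>s. c * Q (k + 1) s) \<longlongrightarrow> c * Q (k + 1) 0) (at_right 0)"
      by (intro tendsto_intros lim)
    show "eventually (\<lambda>s. c * Q (k + 1) s \<le> Q k s) (at_right 0)"
      using Q_ineq by (auto simp: eventually_at_right_field intro!: exI[of _ 1])
  qed (use lim in auto)
  \<comment> \<open>The weight of \<open>U\<close> splits over \<open>A\<close> and
    \<open>U - A\<close> and restores the contracted weights in both factors. It is the same for
    every \<open>A\<close> and \<open>l\<close>, so the inequality can be multiplied by it.\<close>
  have eq: "(\<Prod>e\<in>U. y e) * Q l 0 = (\<Sum>A\<in>{A. A \<subseteq> U \<and> card A = l}.
      trace_poly M S (I \<union> A) y * trace_poly M S (I \<union> (U - A)) y)" for l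
  proof -
    have "(\<Prod>e\<in>U. y e) * (q A 0 * q (U - A) 0)
        = trace_poly M S (I \<union> A) y * trace_poly M S (I \<union> (U - A)) y" if A: "A \<subseteq> U" for A
      unfolding q_0[OF A, symmetric] q_0[of "U - A", OF Diff_subset, symmetric]
        prod.subset_diff[OF A finU, of y]
      by (simp only: mult_ac)
    then show ?thesis
      unfolding Q_def sum_distrib_left by (intro sum.cong) auto
  qed
  have "0 \<le> (\<Prod>e\<in>U. y e)"
    using pos U S by (intro prod_nonneg) (force simp: positive_weights_def intro: less_imp_le)
  with Q_ineq_0 have "(\<Prod>e\<in>U. y e) * (c * Q (k + 1) 0) \<le> (\<Prod>e\<in>U. y e) * Q k 0"
    by (intro mult_left_mono)
  then show ?thesis
    unfolding mult.left_commute[of _ c] eq .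
qed

end

section \<open>Sums over pairs of subsets\<close>

text \<open>A pair is determined by its intersection \<open>I\<close>, its symmetric difference
  \<open>U\<close>, and the part of \<open>U\<close> that belongs to the first set; any such triple
  occurs.\<close>

lemma sum_pairs_by_intersection:
  fixes h :: "'a set \<Rightarrow> 'a set \<Rightarrow> 'b::comm_monoid_add"
  assumes "finite S"
  shows "(\<Sum>A\<in>Pow S. \<Sum>B\<in>Pow S. h A B) =
    (\<Sum>I\<in>Pow S. \<Sum>U\<in>Pow (S - I). \<Sum>A\<in>Pow U. h (I \<union> A) (I \<union> (U - A)))"
proof -
  have fin: "finite X" if "X \<subseteq> S" for X
    using that assms finite_subset by blast
  have "(\<Sum>A\<in>Pow S. \<Sum>B\<in>Pow S. h A B) = (\<Sum>(A, B)\<in>Pow S \<times> Pow S. h A B)"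
    by (rule sum.cartesian_product)
  also have "\<dots> = (\<Sum>(I, U, A)\<in>Sigma (Pow S) (\<lambda>I. Sigma (Pow (S - I)) Pow).
      h (I \<union> A) (I \<union> (U - A)))"
    by (rule sum.reindex_bij_witness[where
          i = "\<lambda>(I, U, A). (I \<union> A, I \<union> (U - A))" and
          j = "\<lambda>(A, B). (A \<inter> B, (A - B) \<union> (B - A), A - B)"])
      (auto intro!: arg_cong2[of _ _ _ _ h])
  also have "\<dots> = (\<Sum>I\<in>Pow S. \<Sum>(U, A)\<in>Sigma (Pow (S - I)) Pow. h (I \<union> A) (I \<union> (U - A)))"
    by (subst sum.Sigma) (use assms in \<open>auto intro!: fin finite_SigmaI\<close>)
  also have "\<dots> = (\<Sum>I\<in>Pow S. \<Sum>U\<in>Pow (S - I). \<Sum>A\<in>Pow U. h (I \<union> A) (I \<union> (U - A)))"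
    by (intro sum.cong refl, subst sum.Sigma) (use assms in \<open>auto intro!: fin\<close>)
  finally show ?thesis .
qed

text \<open>The last index fixes \<open>card (A - B)\<close>, hence also the size
  \<open>2 * i + b - a\<close> of the symmetric difference. Thus the indices \<open>j j i\<close>
  and \<open>(j + 1) (j - 1) (i + 1)\<close> both describe pairs with symmetric difference of size
  \<open>2 * i\<close>.\<close>

definition pair_sum ::
  "('a set \<Rightarrow> real) \<Rightarrow> 'a set \<Rightarrow> nat \<Rightarrow> nat \<Rightarrow> nat \<Rightarrow> real" where
  "pair_sum p S a b i =
    (\<Sum>A\<in>Pow S. \<Sum>B\<in>Pow S. if card A = a \<and> card B = b \<and> card (A - B) = i then p A * p B else 0)"

lemma pair_sum_nonneg:
  assumes "\<And>A. 0 \<le> p A"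
  shows "0 \<le> pair_sum p S a b i"
  unfolding pair_sum_def by (intro sum_nonneg) (use assms in auto)

text \<open>No pair qualifies, because \<open>A \<subseteq> B \<union> (A - B)\<close>,
  \<open>A - B \<subseteq> A\<close> and \<open>B \<union> (A - B) \<subseteq> S\<close>; each
  alternative contradicts one of these inclusions.\<close>

lemma pair_sum_eq_0:
  assumes "finite S" and "b + i < a \<or> a < i \<or> card S < b + i"
  shows "pair_sum p S a b i = 0"
proof -
  have bounds: "card A \<le> card B + card (A - B)" "card (A - B) \<le> card A"
      "card B + card (A - B) \<le> card S" if "A \<subseteq> S" "B \<subseteq> S" for A B
  proof -
    have fin: "finite A" "finite B"
      using that assms(1) finite_subset by blast+
    have "card (B \<union> (A - B)) = card B + card (A - B)"
      by (rule card_Un_disjoint) (use fin in auto)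
    moreover have "card A \<le> card (B \<union> (A - B))" "card (B \<union> (A - B)) \<le> card S"
      by (rule card_mono; use fin assms(1) that in auto)+
    ultimately show "card A \<le> card B + card (A - B)" "card B + card (A - B) \<le> card S"
      by linarith+
    show "card (A - B) \<le> card A"
      by (rule card_mono) (use fin in auto)
  qed
  have "\<not> (card A = a \<and> card B = b \<and> card (A - B) = i)" if "A \<in> Pow S" "B \<in> Pow S" for A B
    using bounds[of A B] that assms(2) by auto
  then show ?thesis
    unfolding pair_sum_def by (intro sum.neutral ballI) (simp only: if_False)
qed

text \<open>Every pair in the expanded product has exactly one value of \<open>card (A - B)\<close>,
  and it is at most \<open>a\<close>.\<close>

lemma sum_mult_sum_eq_sum_pair_sum:
  assumes "finite S"
  shows "(\<Sum>A\<in>{A. A \<subseteq> S \<and> card A = a}. p A) * (\<Sum>B\<in>{B. B \<subseteq> S \<and> card B = b}. p B)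
    = (\<Sum>i\<le>a. pair_sum p S a b i)"
proof -
  have level: "(\<Sum>A\<in>{A. A \<subseteq> S \<and> card A = l}. p A) = (\<Sum>A\<in>Pow S. if card A = l then p A else 0)"
    for l
  proof -
    have "{A. A \<subseteq> S \<and> card A = l} = {A \<in> Pow S. card A = l}" by auto
    then show ?thesis using sum.inter_filter[of "Pow S"] assms by simp
  qed
  have split_diff: "(\<Sum>i\<le>a. if card A = a \<and> card B = b \<and> card (A - B) = i then p A * p B else 0)
      = (if card A = a then p A else 0) * (if card B = b then p B else 0)"
    if "A \<subseteq> S" for A B
  proof -
    have "finite A" using that assms finite_subset by blast
    then have "card A = a \<Longrightarrow> card (A - B) \<le> a"
      using card_mono[of A "A - B"] by auto
    then show ?thesis
      by (auto simp: sum.delta)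
  qed
  have "(\<Sum>i\<le>a. pair_sum p S a b i) = (\<Sum>A\<in>Pow S. \<Sum>B\<in>Pow S. \<Sum>i\<le>a.
      if card A = a \<and> card B = b \<and> card (A - B) = i then p A * p B else 0)"
    unfolding pair_sum_def
    by (subst sum.swap, intro sum.cong refl, subst sum.swap) simp
  also have "\<dots> = (\<Sum>A\<in>Pow S. \<Sum>B\<in>Pow S.
      (if card A = a then p A else 0) * (if card B = b then p B else 0))"
    by (intro sum.cong refl split_diff) auto
  also have "\<dots> = (\<Sum>A\<in>Pow S. if card A = a then p A else 0) * (\<Sum>B\<in>Pow S. if card B = b then p B else 0)"
    by (simp only: sum_product)
  finally show ?thesis by (simp only: level)
qed

text \<open>The parameters \<open>l\<close>, \<open>d\<close>, \<open>e\<close> are the sizes of the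
  intersection and of the two differences of a pair.\<close>

lemma pair_sum_by_intersection:
  assumes "finite S"
  shows "pair_sum p S (l + d) (l + e) d =
    (\<Sum>I\<in>Pow S. \<Sum>U\<in>Pow (S - I). if card I = l \<and> card U = d + e then
      (\<Sum>A\<in>{A. A \<subseteq> U \<and> card A = d}. p (I \<union> A) * p (I \<union> (U - A))) else 0)"
  unfolding pair_sum_def sum_pairs_by_intersection[OF assms]
proof (intro sum.cong refl)
  fix I U assume "I \<in> Pow S" "U \<in> Pow (S - I)"
  then have fin: "finite I" "finite U" and disj: "I \<inter> U = {}"
    using assms finite_subset by (blast intro: finite_subset)+
  have "card (I \<union> A) = l + d \<and> card (I \<union> (U - A)) = l + e \<and> card (I \<union> A - (I \<union> (U - A))) = d
      \<longleftrightarrow> (card I = l \<and> card U = d + e) \<and> card A = d" if A: "A \<subseteq> U" for A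
  proof -
    have fA: "finite A" using A fin finite_subset by blast
    have "card (I \<union> A) = card I + card A" "card (I \<union> (U - A)) = card I + card (U - A)"
      by (rule card_Un_disjoint; use fin fA disj A in auto)+
    moreover have "I \<union> A - (I \<union> (U - A)) = A" using A disj by auto
    moreover have "card U = card A + card (U - A)"
      using A fin by (metis card_Int_Diff inf.absorb_iff2)
    ultimately show ?thesis by auto
  qed
  then have "(\<Sum>A\<in>Pow U. if card (I \<union> A) = l + d \<and> card (I \<union> (U - A)) = l + e \<and>
        card (I \<union> A - (I \<union> (U - A))) = d then p (I \<union> A) * p (I \<union> (U - A)) else 0)
      = (\<Sum>A\<in>Pow U. if (card I = l \<and> card U = d + e) \<and> card A = d
          then p (I \<union> A) * p (I \<union> (U - A)) else 0)"
    by (intro sum.cong refl if_cong) auto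
  also have "\<dots> = (if card I = l \<and> card U = d + e then
      (\<Sum>A\<in>{A \<in> Pow U. card A = d}. p (I \<union> A) * p (I \<union> (U - A))) else 0)"
    using fin by (subst sum.inter_filter) auto
  also have "{A \<in> Pow U. card A = d} = {A. A \<subseteq> U \<and> card A = d}" by auto
  finally show "(\<Sum>A\<in>Pow U. if card (I \<union> A) = l + d \<and> card (I \<union> (U - A)) = l + e \<and>
        card (I \<union> A - (I \<union> (U - A))) = d then p (I \<union> A) * p (I \<union> (U - A)) else 0)
      = (if card I = l \<and> card U = d + e then
      (\<Sum>A\<in>{A. A \<subseteq> U \<and> card A = d}. p (I \<union> A) * p (I \<union> (U - A))) else 0)" .
qed

text \<open>Both sides decompose over the same \<open>I\<close> of size \<open>j - i\<close> and
  \<open>U\<close> of size \<open>2 * i\<close>, so the Ray inequality for each \<open>I\<close> and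
  \<open>U\<close> can be summed.\<close>

lemma (in matroid) Ray_pair_sum:
  assumes ray: "Ray c i E M" and pos: "positive_weights E y" and S: "S \<subseteq> E"
    and i: "1 \<le> i" "i \<le> j"
  shows "c * pair_sum (\<lambda>A. trace_poly M S A y) S (j + 1) (j - 1) (i + 1)
    \<le> pair_sum (\<lambda>A. trace_poly M S A y) S j j i"
proof -
  have fS: "finite S" using S finite_ground finite_subset by blast
  have idx: "j + 1 = (j - i) + (i + 1)" "j - 1 = (j - i) + (i - 1)" "j = (j - i) + i"
    using i by auto
  have "i + 1 + (i - 1) = 2 * i" "i + i = 2 * i" using i by auto
  then show ?thesis
    using pair_sum_by_intersection[OF fS, of "\<lambda>A. trace_poly M S A y" "j - i" "i + 1" "i - 1"]
      pair_sum_by_intersection[OF fS, of "\<lambda>A. trace_poly M S A y" "j - i" i i]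
    unfolding idx[symmetric]
    by (auto simp only: sum_distrib_left[of c "\<lambda>I. sum _ (Pow (S - I))"]
          sum_distrib_left[of c _ "Pow _"] if_distrib[of "(*) c"] mult_zero_right Pow_iff
        intro!: sum_mono split: if_split intro: Ray_trace_poly[OF ray pos S])
qed

section \<open>The diagonal and the Johnson graph\<close>

lemma pair_sum_diagonal:
  assumes "finite S"
  shows "pair_sum p S j j 0 = (\<Sum>A\<in>{A. A \<subseteq> S \<and> card A = j}. (p A)\<^sup>2)"
proof -
  have eq: "card A = j \<and> card B = j \<and> card (A - B) = 0 \<longleftrightarrow> B = A \<and> card A = j"
    if "A \<subseteq> S" "B \<subseteq> S" for A B
  proof -
    have fin: "finite A" "finite B" using that assms finite_subset by blast+
    then have "card (A - B) = 0 \<longleftrightarrow> A \<subseteq> B" by simp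
    moreover have "A \<subseteq> B \<and> card A = card B \<longleftrightarrow> B = A"
      using card_subset_eq[OF fin(2), of A] by blast
    ultimately show ?thesis by metis
  qed
  have "pair_sum p S j j 0 =
      (\<Sum>A\<in>Pow S. \<Sum>B\<in>Pow S. if B = A then if card A = j then (p A)\<^sup>2 else 0 else 0)"
    unfolding pair_sum_def by (intro sum.cong refl) (auto simp: eq power2_eq_square)
  also have "\<dots> = (\<Sum>A\<in>Pow S. if card A = j then (p A)\<^sup>2 else 0)"
    using assms by (intro sum.cong) (auto simp: sum.delta)
  also have "\<dots> = (\<Sum>A\<in>{A \<in> Pow S. card A = j}. (p A)\<^sup>2)"
    using assms by (subst sum.inter_filter) auto
  also have "{A \<in> Pow S. card A = j} = {A. A \<subseteq> S \<and> card A = j}" by auto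
  finally show ?thesis .
qed

text \<open>Every neighbour arises by exchanging some \<open>e\<close> in \<open>A\<close> for some
  \<open>f\<close> in \<open>S - A\<close>.\<close>

lemma card_Johnson_neighbours_le:
  assumes "finite S" "A \<subseteq> S"
  shows "card {B. B \<subseteq> S \<and> card B = card A \<and> card (A - B) = 1} \<le> card A * (card S - card A)"
proof -
  have fA: "finite A" using assms finite_subset by blast
  have "{B. B \<subseteq> S \<and> card B = card A \<and> card (A - B) = 1}
      \<subseteq> (\<lambda>(e, f). insert f (A - {e})) ` (A \<times> (S - A))"
  proof
    fix B assume "B \<in> {B. B \<subseteq> S \<and> card B = card A \<and> card (A - B) = 1}"
    then have B: "B \<subseteq> S" "card B = card A" "card (A - B) = 1" by auto
    have fB: "finite B" using B assms finite_subset by blast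
    have "card (B - A) = 1"
      using card_Int_Diff[OF fA, of B] card_Int_Diff[OF fB, of A] B by (simp add: Int_commute)
    then obtain e f where ef: "A - B = {e}" "B - A = {f}"
      using B by (auto simp: card_1_singleton_iff)
    then have "B = insert f (A - {e})" by blast
    moreover have "e \<in> A" "f \<in> S - A" using ef B by blast+
    ultimately show "B \<in> (\<lambda>(e, f). insert f (A - {e})) ` (A \<times> (S - A))"
      by (intro image_eqI[of _ _ "(e, f)"]) auto
  qed
  then have "card {B. B \<subseteq> S \<and> card B = card A \<and> card (A - B) = 1} \<le> card (A \<times> (S - A))"
    using fA assms by (intro surj_card_le) auto
  then show ?thesis using assms fA by (simp add: card_cartesian_product card_Diff_subset)
qed

text \<open>The relation is symmetric: finite sets of equal size satisfy
  \<open>card (A - B) = card (B - A)\<close>.\<close>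

lemma sum_Johnson_neighbours_swap:
  assumes "finite S"
  shows "(\<Sum>A\<in>Pow S. \<Sum>B\<in>Pow S. if card A = j \<and> card B = j \<and> card (A - B) = i then f B else 0)
    = (\<Sum>A\<in>Pow S. \<Sum>B\<in>Pow S. if card A = j \<and> card B = j \<and> card (A - B) = i then f A else (0::real))"
proof (subst sum.swap, intro sum.cong refl if_cong)
  fix A B assume "A \<in> Pow S" "B \<in> Pow S"
  then have "finite A" "finite B" using assms finite_subset by auto
  then have "card A = card B \<Longrightarrow> card (A - B) = card (B - A)"
    using card_Int_Diff[of A B] card_Int_Diff[of B A] by (simp add: Int_commute)
  then show "(card B = j \<and> card A = j \<and> card (B - A) = i)
      = (card A = j \<and> card B = j \<and> card (A - B) = i)" by auto
qed

text \<open>Bound \<open>2 * p A * p B\<close> by the sum of the two squares. By symmetry both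
  squares contribute equally, and each is counted at most as often as the degree bound
  allows.\<close>

lemma pair_sum_Johnson_le:
  assumes "finite S"
  shows "pair_sum p S j j 1 \<le> real (j * (card S - j)) * pair_sum p S j j 0"
proof -
  let ?N = "\<lambda>A B. card A = j \<and> card B = j \<and> card (A - B) = 1"
  have "2 * pair_sum p S j j 1
      \<le> (\<Sum>A\<in>Pow S. \<Sum>B\<in>Pow S. if ?N A B then (p A)\<^sup>2 else 0)
        + (\<Sum>A\<in>Pow S. \<Sum>B\<in>Pow S. if ?N A B then (p B)\<^sup>2 else 0)"
    unfolding pair_sum_def sum_distrib_left sum.distrib[symmetric]
    by (intro sum_mono) (use sum_squares_bound[of "p _" "p _"] in \<open>auto simp: mult.assoc\<close>)
  also have "\<dots> = 2 * (\<Sum>A\<in>Pow S. \<Sum>B\<in>Pow S. if ?N A B then (p A)\<^sup>2 else 0)"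
    by (subst sum_Johnson_neighbours_swap[OF assms]) simp
  finally have "pair_sum p S j j 1 \<le> (\<Sum>A\<in>Pow S. \<Sum>B\<in>Pow S. if ?N A B then (p A)\<^sup>2 else 0)"
    by simp
  also have "\<dots> \<le> (\<Sum>A\<in>Pow S. if card A = j then real (j * (card S - j)) * (p A)\<^sup>2 else 0)"
  proof (rule sum_mono)
    fix A assume A: "A \<in> Pow S"
    show "(\<Sum>B\<in>Pow S. if ?N A B then (p A)\<^sup>2 else 0)
        \<le> (if card A = j then real (j * (card S - j)) * (p A)\<^sup>2 else 0)"
    proof (cases "card A = j")
      case True
      have "{B \<in> Pow S. ?N A B} = {B. B \<subseteq> S \<and> card B = card A \<and> card (A - B) = 1}"
        using True by auto
      then have "(\<Sum>B\<in>Pow S. if ?N A B then (p A)\<^sup>2 else 0)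
          = real (card {B. B \<subseteq> S \<and> card B = card A \<and> card (A - B) = 1}) * (p A)\<^sup>2"
        using sum.inter_filter[of "Pow S" "\<lambda>B. (p A)\<^sup>2" "?N A"] assms by simp
      also have "\<dots> \<le> real (j * (card S - j)) * (p A)\<^sup>2"
        using card_Johnson_neighbours_le[of S A] A True assms
        by (intro mult_right_mono) (auto simp del: of_nat_mult)
      finally show ?thesis using True by simp
    qed simp
  qed
  also have "\<dots> = (\<Sum>A\<in>{A \<in> Pow S. card A = j}. real (j * (card S - j)) * (p A)\<^sup>2)"
    using assms by (subst sum.inter_filter) auto
  also have "\<dots> = real (j * (card S - j)) * pair_sum p S j j 0"
    by (simp add: pair_sum_diagonal[OF assms] sum_distrib_left Pow_def)
  finally show ?thesis .
qed

section \<open>Estimates for the BLC constant\<close>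

text \<open>With \<open>a = j\<close> and \<open>b = n - j\<close> the left side is the BLC
  constant; the product form is visibly decreasing in \<open>a\<close> and \<open>b\<close>.\<close>

lemma BLC_constant_eq:
  fixes a b :: real
  assumes "0 < a" "0 < b"
  shows "1 + (a + b + 1) / (a * b) = (1 + 1 / a) * (1 + 1 / b)"
  using assms by (simp add: field_simps)

lemma BLC_constant_le:
  fixes a b i :: real
  assumes "0 < i" "i \<le> a" "i \<le> b"
  shows "(1 + 1 / a) * (1 + 1 / b) \<le> (1 + 1 / i)\<^sup>2"
  unfolding power2_eq_square using assms by (intro mult_mono add_left_mono divide_left_mono) auto

text \<open>From \<open>(a - 1) * (b - 1) \<ge> 0\<close> follows
  \<open>a * b + a + b + 1 \<le> 2 * (1 + a * b)\<close>. The factor 2 is absorbed by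
  \<open>2 * Y \<le> X1\<close>, and the extra \<open>X1\<close> left over is at most
  \<open>a * b * X0\<close>.\<close>

lemma BLC_first_terms:
  fixes a b X0 X1 Y :: real
  assumes "1 \<le> a" "1 \<le> b" "X1 \<le> a * b * X0" "2 * Y \<le> X1" "0 \<le> Y"
  shows "(1 + (a + b + 1) / (a * b)) * Y \<le> X0 + X1"
proof -
  have ab: "0 < a * b" using assms by simp
  have "0 \<le> (a - 1) * (b - 1)" using assms by simp
  then have "a + b - 1 \<le> a * b" by (simp add: algebra_simps)
  then have "(a * b + (a + b + 1)) * Y \<le> (1 + a * b) * (2 * Y)"
    using assms(5) by (simp add: mult.assoc[symmetric] mult_right_mono)
  also have "\<dots> \<le> (1 + a * b) * X1"
    using assms ab by (intro mult_left_mono) auto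
  also have "\<dots> \<le> a * b * (X0 + X1)"
    using assms by (simp add: algebra_simps)
  finally have "(a * b + (a + b + 1)) * Y / (a * b) \<le> X0 + X1"
    using ab by (simp add: pos_divide_le_eq mult.commute)
  moreover have "(a * b + (a + b + 1)) * Y / (a * b) = (1 + (a + b + 1) / (a * b)) * Y"
    using assms by (simp add: field_simps)
  ultimately show ?thesis by simp
qed

section \<open>Comparison of the two expansions term by term\<close>

theorem theorem4p3:
  fixes E :: "'a set" and M :: "'a set set" and m :: nat
  assumes "m \<ge> 1"
    and "matroid E M"
    and "Ray 2 1 E M"
    and "\<And>k. 2 \<le> k \<Longrightarrow> k \<le> m \<Longrightarrow> Ray ((1 + 1 / real k)\<^sup>2) k E M"
  shows "BLC (2 * m + 1) E M"
  unfolding BLC_def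
proof (intro allI impI)
  fix y S n j
  assume pos: "positive_weights E y" and S: "S \<subseteq> E" and n: "card S = n" "n \<le> 2 * m + 1"
    and j: "1 \<le> j" "j \<le> n - 1"
  interpret matroid E M by fact
  have fS: "finite S" using S finite_ground finite_subset by blast
  define p where "p A = trace_poly M S A y" for A
  define X where "X i = pair_sum p S j j i" for i
  \<comment> \<open>The shift to \<open>i + 1\<close> aligns \<open>Y i\<close> with
    \<open>X i\<close>: both belong to symmetric differences of size \<open>2 * i\<close>.\<close>
  define Y where "Y i = pair_sum p S (j + 1) (j - 1) (i + 1)" for i
  define b where "b = n - j"
  have b: "1 \<le> b" "real n = real j + real b" using j by (auto simp: b_def)
  define c where "c = 1 + (real j + real b + 1) / (real j * real b)"
  have Y_nonneg: "0 \<le> Y i" for i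
    unfolding Y_def p_def by (intro pair_sum_nonneg trace_poly_nonneg pos)
  have square: "(level_poly M j S y)\<^sup>2 = (\<Sum>i\<le>j. X i)"
    using sum_mult_sum_eq_sum_pair_sum[OF fS, of p j j]
    by (simp add: power2_eq_square level_poly_eq_sum_trace_poly[OF S] X_def p_def)
  have "level_poly M (j - 1) S y * level_poly M (j + 1) S y
      = (\<Sum>i\<le>j + 1. pair_sum p S (j + 1) (j - 1) i)"
    using sum_mult_sum_eq_sum_pair_sum[OF fS, of p "j + 1" "j - 1"]
    by (simp add: mult.commute level_poly_eq_sum_trace_poly[OF S] p_def)
  also have "\<dots> = pair_sum p S (j + 1) (j - 1) 0 + (\<Sum>i\<le>j. Y i)"
    by (simp only: Y_def Suc_eq_plus1[symmetric] sum.atMost_Suc_shift)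
  also have "pair_sum p S (j + 1) (j - 1) 0 = 0"
    by (rule pair_sum_eq_0) (use fS j in auto)
  finally have product: "level_poly M (j - 1) S y * level_poly M (j + 1) S y = (\<Sum>i\<le>j. Y i)"
    by simp
  have split: "(\<Sum>i\<le>j. f i) = f 0 + f 1 + (\<Sum>i\<in>{2..j}. f i)" for f :: "nat \<Rightarrow> real"
  proof -
    have "{..j} = insert 0 (insert 1 {2..j})" using j by auto
    then show ?thesis by (simp add: add.assoc)
  qed
  \<comment> \<open>The sizes \<open>j + 1\<close> and \<open>j - 1\<close> force a difference of at
    least two elements, while \<open>Y 0\<close> asks for one.\<close>
  have Y0: "Y 0 = 0"
    unfolding Y_def by (rule pair_sum_eq_0) (use fS j in auto)
  have first: "c * Y 1 \<le> X 0 + X 1"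
    unfolding c_def
  proof (rule BLC_first_terms)
    show "X 1 \<le> real j * real b * X 0"
      using pair_sum_Johnson_le[OF fS, of p j] n by (simp add: X_def b_def)
    show "2 * Y 1 \<le> X 1"
      unfolding X_def Y_def p_def by (rule Ray_pair_sum[OF assms(3) pos S]) (use j in auto)
  qed (use j b Y_nonneg in auto)
  have rest: "c * Y i \<le> X i" if i: "i \<in> {2..j}" for i
  proof (cases "i \<le> b")
    case True
    \<comment> \<open>Here \<open>i \<le> j\<close> and \<open>i \<le> n - j\<close> give
      \<open>2 * i \<le> n \<le> 2 * m + 1\<close>.\<close>
    then have "i \<le> m" using i n j by (auto simp: b_def)
    then have "(1 + 1 / real i)\<^sup>2 * Y i \<le> X i"
      unfolding X_def Y_def p_def
      by (intro Ray_pair_sum assms(4) pos S) (use i in auto)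
    moreover have "c \<le> (1 + 1 / real i)\<^sup>2"
      unfolding c_def using i True j b
      by (subst BLC_constant_eq) (auto intro!: BLC_constant_le)
    ultimately show ?thesis
      using mult_right_mono[OF _ Y_nonneg, of c] order_trans by blast
  next
    case False
    \<comment> \<open>The union of such a pair would have \<open>(j - 1) + (i + 1) = j + i\<close>
      elements, more than \<open>n\<close>.\<close>
    have "Y i = 0"
      unfolding Y_def by (rule pair_sum_eq_0) (use fS False n j in \<open>auto simp: b_def\<close>)
    moreover have "0 \<le> X i"
      unfolding X_def p_def by (intro pair_sum_nonneg trace_poly_nonneg pos)
    ultimately show ?thesis by simp
  qed
  have "c * (\<Sum>i\<le>j. Y i) = c * Y 1 + (\<Sum>i\<in>{2..j}. c * Y i)"
    by (simp add: split Y0 sum_distrib_left distrib_left)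
  also have "\<dots> \<le> (\<Sum>i\<le>j. X i)"
    using first sum_mono[of "{2..j}" "\<lambda>i. c * Y i" X] rest by (simp add: split)
  finally have "c * (level_poly M (j - 1) S y * level_poly M (j + 1) S y) \<le> (level_poly M j S y)\<^sup>2"
    by (simp only: square product)
  then show "(1 + (real n + 1) / (real j * (real n - real j))) *
      level_poly M (j - 1) S y * level_poly M (j + 1) S y \<le> (level_poly M j S y)\<^sup>2"
    using b by (simp add: c_def mult.assoc)
qed

end
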